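(* Let $n\in\mathbb{N}\setminus\{1\}$, let $\varepsilon=\sqrt{\frac{\ln n}{n-1}}$, let $f<(n-1)(1-\varepsilon)$ and let $F\subseteq[n-1]$ with $|F|=f$. Let $p=1-\frac{f}{n-1}$ and let $c>1$ be a constant. If all processors in $F$ are faulty (and all others non-faulty), then the randomized $\mathrm{GP}$ algorithm has time complexity $T\le\frac{c}{p-\varepsilon}\left(\lceil\log(n-1)\rceil+1\right)$ with probability at least $1-\frac{n^3}{n^2-1}\exp\left(-\frac{(c-1)^2}{2c}\left(\lceil\log(n-1)\rceil-1\right)\right)$.
   Context: $\log$ is to base 2, $\ln$ the natural logarithm, $[n-1]=\{1,\ldots,n-1\}$, $S_{n-1}$ the set of permutations of $[n-1]$. For a sequence $s=(s_1,s_2,\ldots)$, $\mathrm{ODD}(s)=(s_1,s_3,\ldots)$, $\mathrm{EVEN}(s)=(s_2,s_4,\ldots)$. There are $n$ processors $0,\ldots,n-1$; processor $0$ initially holds the rumor and is non-faulty; faulty processors never send messages or respond, and a caller learns that a call to a faulty processor failed. The randomized $\mathrm{GP}$ algorithm: processor $0$ picks $\pi\in S_{n-1}$ uniformly at random and starts with the list $(\pi(1),\ldots,\pi(n-1))$; all other processors start with empty lists. In each synchronous round, every processor $i$ holding a nonempty list $(j_1,\ldots,j_k)$ sends a communication request to $j_1$ and deletes $j_1$ from its list; if $j_1$ is non-faulty, $i$ sends it the rumor together with the list $\mathrm{EVEN}(j_2,\ldots,j_k)$, which becomes $j_1$'s list, and $i$ sets its own list to $\mathrm{ODD}(j_2,\ldots,j_k)$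 (if $j_1$ is faulty, $i$ continues with $(j_2,\ldots,j_k)$). The algorithm terminates when all lists are empty; its time complexity is the number of rounds until termination. The probability is over the random choice of $\pi$. *)

theory Defs
  imports "HOL-Probability.Probability" "HOL-Combinatorics.Permutations"
begin

text \<open>Sequences are numbered from 1 in the source, list indices from 0; hence \<open>ODD\<close>
  keeps the even indices.\<close>

definition ODD :: "'a list \<Rightarrow> 'a list" where
  "ODD xs = nths xs {i. even i}"

definition EVEN :: "'a list \<Rightarrow> 'a list" where
  "EVEN xs = nths xs {i. odd i}"

text \<open>A configuration assigns to every processor its current list. The rumor itself is not
  recorded: it is transmitted exactly when a list (possibly empty) is handed over, and it has no
  influence on the number of rounds. Processors are the naturals below \<open>n\<close>; all other naturals
  keep the empty list throughout.\<close>

type_synonym gp_config = "nat \<Rightarrow> nat list"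

definition calls :: "gp_config \<Rightarrow> nat \<Rightarrow> nat \<Rightarrow> bool" where
  "calls L j i \<longleftrightarrow> L j \<noteq> [] \<and> hd (L j) = i"

text \<open>In every configuration reachable from \<open>gp_init\<close> the lists are distinct, pairwise disjoint,
  and do not mention any processor that currently holds a nonempty list. So the caller of a
  called processor is unique, and a called processor is idle. Faulty processors are never handed
  a list (and processor 0 is not faulty), so they never act.\<close>

definition gp_round :: "nat set \<Rightarrow> gp_config \<Rightarrow> gp_config" where
  "gp_round F L = (\<lambda>i.
     if i \<notin> F \<and> (\<exists>j. calls L j i) then EVEN (tl (L (THE j. calls L j i)))
     else if L i = [] then []
     else if hd (L i) \<in> F then tl (L i)
     else ODD (tl (L i)))"

definition gp_init :: "nat \<Rightarrow> (nat \<Rightarrow> nat) \<Rightarrow> gp_config" where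
  "gp_init n \<pi> = (\<lambda>i. if i = 0 then map \<pi> [1..<n] else [])"

definition gp_config_after :: "nat \<Rightarrow> nat set \<Rightarrow> (nat \<Rightarrow> nat) \<Rightarrow> nat \<Rightarrow> gp_config" where
  "gp_config_after n F \<pi> t = (gp_round F ^^ t) (gp_init n \<pi>)"

definition gp_time :: "nat \<Rightarrow> nat set \<Rightarrow> (nat \<Rightarrow> nat) \<Rightarrow> nat" where
  "gp_time n F \<pi> = (LEAST t. \<forall>i. gp_config_after n F \<pi> t i = [])"

definition gp_perm_pmf :: "nat \<Rightarrow> (nat \<Rightarrow> nat) pmf" where
  "gp_perm_pmf n = pmf_of_set {\<pi>. \<pi> permutes {1..n - 1}}"

text \<open>The minimum in \<open>gp_time\<close> always exists.\<close>

lemma gp_round_shorter: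
  assumes "\<And>i. length (L i) \<le> k"
  shows "length (gp_round F L i) \<le> k - 1"
proof -
  have nths_le: "length (nths xs I) \<le> length xs" for xs :: "nat list" and I
    by (induction xs arbitrary: I) (auto simp: nths_Cons le_SucI)
  have "length (L j) - 1 \<le> k - 1" for j
    using assms by (simp add: diff_le_mono)
  then show ?thesis
    unfolding gp_round_def ODD_def EVEN_def
    by (auto intro: order_trans[OF nths_le])
qed

lemma gp_terminates: "\<exists>t. \<forall>i. gp_config_after n F \<pi> t i = []"
proof -
  have "length (gp_config_after n F \<pi> t i) \<le> (n - 1) - t" for t i
  proof (induction t arbitrary: i)
    case 0
    then show ?case by (simp add: gp_config_after_def gp_init_def)
  next
    case (Suc t)
    have "length (gp_round F (gp_config_after n F \<pi> t) i) \<le> (n - 1 - t) - 1"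
      by (rule gp_round_shorter) (rule Suc.IH)
    then show ?case by (simp add: gp_config_after_def)
  qed
  from this[of "n - 1"] show ?thesis by auto
qed

end

theory Submission
  imports Defs
begin

text \<open>Only the set of positions of the faulty processors in \<open>\<pi>\<close> matters, and it is a uniformly
  random \<open>f\<close>-subset. Follow the potential \<open>\<Sum> m powr (1 + log 2 c)\<close> over the lengths \<open>m\<close>
  of all current lists: in expectation it shrinks per round by the factor \<open>1 - p (1 - 1 / c)\<close> if
  positions are sampled with replacement, and sampling without replacement is no worse by
  Maclaurin's inequality. Markov's inequality then gives the Chernoff bound together with the union
  bound over all branches, already with \<open>p\<close> in place of \<open>p - \<epsilon>\<close>.\<close>

section \<open>Splitting a list into its odd and even places\<close>

lemma ODD_simps [simp]: "ODD [] = []" "ODD (x # xs) = x # EVEN xs"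
  by (simp_all add: ODD_def EVEN_def nths_Cons)

lemma EVEN_simps [simp]: "EVEN [] = []" "EVEN (x # xs) = ODD xs"
  by (simp_all add: ODD_def EVEN_def nths_Cons)

lemma length_ODD_EVEN:
  "length (ODD xs) = Suc (length xs) div 2 \<and> length (EVEN xs) = length xs div 2"
  by (induction xs) auto

lemma set_ODD_subset: "set (ODD xs) \<subseteq> set xs"
  and set_EVEN_subset: "set (EVEN xs) \<subseteq> set xs"
  by (simp_all add: ODD_def EVEN_def set_nths_subset)

lemma distinct_ODD: "distinct xs \<Longrightarrow> distinct (ODD xs)"
  and distinct_EVEN: "distinct xs \<Longrightarrow> distinct (EVEN xs)"
  by (simp_all add: ODD_def EVEN_def)

lemma ODD_EVEN_disjoint: "distinct xs \<Longrightarrow> set (ODD xs) \<inter> set (EVEN xs) = {}"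
proof (induction xs)
  case (Cons x xs)
  then show ?case
    using set_ODD_subset[of xs] by auto
qed simp

lemma map_ODD: "map g (ODD xs) = ODD (map g xs)"
  and map_EVEN: "map g (EVEN xs) = EVEN (map g xs)"
  by (simp_all add: ODD_def EVEN_def nths_map)

section \<open>From the protocol to a tree of lists\<close>

text \<open>Forgets who holds which list: a list evolves by itself, depending only on which of its
  entries satisfy \<open>B\<close>. The disjunction follows a binary tree of descendants, and any
  nonempty one keeps the protocol running.\<close>

primrec alive :: "('a \<Rightarrow> bool) \<Rightarrow> nat \<Rightarrow> 'a list \<Rightarrow> bool" where
  "alive B 0 xs \<longleftrightarrow> xs \<noteq> []"
| "alive B (Suc t) xs \<longleftrightarrow> xs \<noteq> [] \<and>
     (if B (hd xs) then alive B t (tl xs)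
      else alive B t (ODD (tl xs)) \<or> alive B t (EVEN (tl xs)))"

lemma alive_Nil [simp]: "\<not> alive B t []"
  by (cases t) auto

lemma alive_map: "alive B t (map g xs) \<longleftrightarrow> alive (B \<circ> g) t xs"
proof (induction t arbitrary: xs)
  case (Suc t)
  then show ?case
    by (cases xs) (simp_all flip: map_ODD map_EVEN)
qed simp

lemma alive_cong: "(\<And>x. x \<in> set xs \<Longrightarrow> B x = C x) \<Longrightarrow> alive B t xs = alive C t xs"
proof (induction t arbitrary: xs)
  case (Suc t)
  show ?case
  proof (cases xs)
    case (Cons x ys)
    have "alive B t zs = alive C t zs" if "set zs \<subseteq> set ys" for zs
      using that Cons Suc.prems by (intro Suc.IH) auto
    from this[of ys] this[OF set_ODD_subset] this[OF set_EVEN_subset] show ?thesis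
      using Cons Suc.prems by simp
  qed simp
qed simp

lemma alive_imp_less_length: "alive B t xs \<Longrightarrow> t < length xs"
proof (induction t arbitrary: xs)
  case (Suc t)
  then obtain x ys where xs: "xs = x # ys"
    by (cases xs) auto
  have "t < length ys \<or> t < length (ODD ys) \<or> t < length (EVEN ys)"
    using Suc.prems Suc.IH by (auto simp: xs split: if_splits)
  with length_ODD_EVEN[of ys] show ?case
    by (auto simp: xs)
qed simp

text \<open>The part of the protocol invariant that makes callers unique. A busy processor that gets
  called would lose its list, which cannot hurt: only an upper bound on the running time is
  sought.\<close>

definition disjoint_lists :: "gp_config \<Rightarrow> bool" where
  "disjoint_lists L \<longleftrightarrow> (\<forall>i. distinct (L i)) \<and> (\<forall>i j. i \<noteq> j \<longrightarrow> set (L i) \<inter> set (L j) = {})"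

lemma caller_unique:
  assumes "disjoint_lists L" "calls L j i"
  shows "(THE j. calls L j i) = j"
proof (rule the_equality)
  fix k assume "calls L k i"
  with assms(2) have "i \<in> set (L k) \<inter> set (L j)"
    by (metis IntI calls_def list.set_sel(1))
  with assms(1) show "k = j"
    by (auto simp: disjoint_lists_def)
qed fact

lemma gp_round_cases:
  assumes "disjoint_lists L"
  obtains (called) j where "i \<notin> F" "calls L j i" "gp_round F L i = EVEN (tl (L j))"
  | (empty) "gp_round F L i = []"
  | (faulty) "L i \<noteq> []" "hd (L i) \<in> F" "gp_round F L i = tl (L i)"
  | (split) "L i \<noteq> []" "hd (L i) \<notin> F" "gp_round F L i = ODD (tl (L i))"
proof (cases "i \<notin> F \<and> (\<exists>j. calls L j i)")
  case True
  then obtain j where "i \<notin> F" "calls L j i" by blast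
  moreover from this have "gp_round F L i = EVEN (tl (L j))"
    using caller_unique[OF assms, of j i] by (auto simp: gp_round_def)
  ultimately show ?thesis
    by (rule that(1))
next
  case False
  then show ?thesis
    using that(2-4) by (cases "L i = []"; cases "hd (L i) \<in> F") (auto simp: gp_round_def)
qed

text \<open>Every new list lies inside one old list. Two new lists come from the same old one only
  after a successful call, where they are its \<open>ODD\<close> and \<open>EVEN\<close>
  parts.\<close>

lemma disjoint_lists_gp_round:
  assumes L: "disjoint_lists L"
  shows "disjoint_lists (gp_round F L)"
proof -
  have dist: "distinct (L i)" "distinct (tl (L i))" for i
    using L by (auto simp: disjoint_lists_def distinct_tl)
  have disj: "set (L i) \<inter> set (L j) = {}" if "i \<noteq> j" for i j
    using L that by (auto simp: disjoint_lists_def)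
  have sub: "set (tl xs) \<subseteq> set xs" "set (ODD (tl xs)) \<subseteq> set xs" "set (EVEN (tl xs)) \<subseteq> set xs"
    for xs :: "nat list"
    using set_ODD_subset[of "tl xs"] set_EVEN_subset[of "tl xs"] by (cases xs; auto)+
  have own: "set (gp_round F L i) \<subseteq> set (L i) \<or>
      (\<exists>j. i \<notin> F \<and> calls L j i \<and> gp_round F L i = EVEN (tl (L j)))" for i
    using sub[of "L i"] by (cases rule: gp_round_cases[OF L, of i F]) auto
  have called_own: "set (gp_round F L i) \<inter> set (gp_round F L k) = {}"
    if "i \<notin> F" and ji: "calls L j i" and i: "gp_round F L i = EVEN (tl (L j))" and "i \<noteq> k" for i j k
  using L
  proof (cases rule: gp_round_cases[of _ k F])
    case (called l)
    then have "j \<noteq> l"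
      using ji that by (auto simp: calls_def)
    then show ?thesis
      unfolding i called(3) using disj sub by blast
  next
    case faulty
    then have "j \<noteq> k"
      using ji that by (auto simp: calls_def)
    then show ?thesis
      unfolding i faulty(3) using disj sub by blast
  next
    case split
    show ?thesis
    proof (cases "j = k")
      case True
      then show ?thesis
        unfolding i split(3) using ODD_EVEN_disjoint[OF dist(2)[of k]] by auto
    next
      case False
      then show ?thesis
        unfolding i split(3) using disj sub by blast
    qed
  qed auto
  have "set (gp_round F L i) \<inter> set (gp_round F L k) = {}" if "i \<noteq> k" for i k
    using own[of i] own[of k] called_own[of i _ k] called_own[of k _ i] that disj[OF that]
    by (metis Int_commute Int_mono subset_empty)
  moreover have "distinct (gp_round F L i)" for i
    by (cases rule: gp_round_cases[OF L, of i F]) (auto simp: dist distinct_ODD distinct_EVEN)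
  ultimately show ?thesis
    by (simp add: disjoint_lists_def)
qed

text \<open>The first round is peeled off, not the last, to match the recursion of
  \<open>alive\<close>: by \<open>gp_round_cases\<close>, every list after it is empty or a child of
  one list before it.\<close>

lemma nonempty_after_rounds_imp_alive:
  assumes "disjoint_lists L" "(gp_round F ^^ t) L i \<noteq> []"
  shows "\<exists>j. alive (\<lambda>x. x \<in> F) t (L j)"
  using assms
proof (induction t arbitrary: L)
  case (Suc t)
  have "(gp_round F ^^ t) (gp_round F L) i \<noteq> []"
    using Suc.prems(2) by (simp add: funpow_swap1)
  with Suc.IH[OF disjoint_lists_gp_round[OF Suc.prems(1)]]
  obtain k where k: "alive (\<lambda>x. x \<in> F) t (gp_round F L k)"
    by blast
  show ?case
  using Suc.prems(1)
  proof (cases rule: gp_round_cases[of _ k F])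
    case (called j)
    with k have "alive (\<lambda>x. x \<in> F) (Suc t) (L j)"
      by (simp add: calls_def)
    then show ?thesis by blast
  next
    case empty
    with k show ?thesis by simp
  next
    case faulty
    with k have "alive (\<lambda>x. x \<in> F) (Suc t) (L k)" by simp
    then show ?thesis by blast
  next
    case split
    with k have "alive (\<lambda>x. x \<in> F) (Suc t) (L k)" by simp
    then show ?thesis by blast
  qed
qed auto

text \<open>Moves from processor names to positions: the list \<open>[1..<n]\<close> is fixed, and
  \<pi> enters only through the set of positions that it maps into \<open>F\<close>.\<close>

lemma gp_time_gt_imp_alive:
  assumes "\<pi> permutes {1..n - 1}" "t < gp_time n F \<pi>"
  shows "alive (\<lambda>i. \<pi> i \<in> F) t [1..<n]"
proof -
  have "\<not> (\<forall>i. gp_config_after n F \<pi> t i = [])"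
    using assms(2) not_less_Least unfolding gp_time_def by blast
  then obtain i where "(gp_round F ^^ t) (gp_init n \<pi>) i \<noteq> []"
    by (auto simp: gp_config_after_def)
  moreover have "disjoint_lists (gp_init n \<pi>)"
    using permutes_inj[OF assms(1)]
    by (auto simp: disjoint_lists_def gp_init_def distinct_map inj_on_def)
  ultimately obtain j where "alive (\<lambda>x. x \<in> F) t (gp_init n \<pi> j)"
    using nonempty_after_rounds_imp_alive by blast
  then have "alive (\<lambda>x. x \<in> F) t (map \<pi> [1..<n])"
    by (auto simp: gp_init_def split: if_splits)
  then show ?thesis
    by (simp add: alive_map comp_def)
qed

section \<open>Sampling without replacement\<close>

text \<open>Sum of \<open>y ^ card (T - G)\<close> over the \<open>f\<close>-subsets \<open>G\<close> of an \<open>M\<close>-set with a fixed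
  \<open>t\<close>-subset \<open>T\<close>, i.e. \<open>M choose f\<close> times the generating function of a hypergeometric
  distribution. Meaningful only for \<open>t \<le> M\<close>.\<close>

primrec hyper_sum :: "real \<Rightarrow> nat \<Rightarrow> nat \<Rightarrow> nat \<Rightarrow> real" where
  "hyper_sum y 0 M f = real (M choose f)"
| "hyper_sum y (Suc t) M f =
     (case f of 0 \<Rightarrow> 0 | Suc f' \<Rightarrow> hyper_sum y t (M - 1) f') + y * hyper_sum y t (M - 1) f"

lemma hyper_sum_nonneg: "0 \<le> y \<Longrightarrow> 0 \<le> hyper_sum y t M f"
  by (induction t arbitrary: M f) (auto split: nat.split)

lemma Suc_times_choose_Suc: "(real f + 1) * real (M choose Suc f) = (real M - real f) * real (M choose f)"
proof (cases "f \<le> M")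
  case True
  have "Suc f * (M choose Suc f) = (M - f) * (M choose f)"
    by (metis binomial_absorb_comp binomial_absorption mult.commute)
  then have "real (Suc f * (M choose Suc f)) = real ((M - f) * (M choose f))"
    by simp
  with True show ?thesis
    by (simp add: of_nat_diff algebra_simps)
qed (simp add: binomial_eq_0)

text \<open>Double counting explains it: an \<open>f\<close>-subset \<open>G\<close> can be enlarged
  in \<open>M - f\<close> ways, and each larger set arises \<open>f + 1\<close> times. Enlarging
  lowers \<open>card (T - G)\<close> by at most one, so \<open>y\<close> times the new weight is at
  most the old weight. Formally, the bounds at \<open>f - 1\<close> and \<open>f\<close> for one
  position fewer are combined.\<close>

lemma hyper_sum_Suc_fault:
  assumes y: "0 \<le> y" "y \<le> 1" and "t \<le> M"
  shows "y * (real f + 1) * hyper_sum y t M (Suc f) \<le> (real M - real f) * hyper_sum y t M f"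
  using \<open>t \<le> M\<close>
proof (induction t arbitrary: M f)
  case 0
  have "y * ((real f + 1) * real (M choose Suc f)) \<le> 1 * ((real f + 1) * real (M choose Suc f))"
    using y by (intro mult_right_mono) auto
  then show ?case
    by (simp add: Suc_times_choose_Suc mult.assoc)
next
  case (Suc t)
  then obtain M' where M: "M = Suc M'" "t \<le> M'"
    by (cases M) auto
  define a where "a = (case f of 0 \<Rightarrow> 0 | Suc f' \<Rightarrow> hyper_sum y t M' f')"
  define b where "b = hyper_sum y t M' f"
  define d where "d = hyper_sum y t M' (Suc f)"
  have ab: "y * real f * b \<le> (real M' + 1 - real f) * a"
  proof (cases f)
    case (Suc f')
    then show ?thesis
      using Suc.IH[OF M(2), of f'] by (simp add: a_def b_def algebra_simps)
  qed (simp add: a_def)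
  have "y * (real f + 1) * d \<le> (real M' - real f) * b"
    using Suc.IH[OF M(2), of f] by (simp add: b_def d_def)
  then have "y * (y * (real f + 1) * d) \<le> y * ((real M' - real f) * b)"
    using y by (intro mult_left_mono) auto
  with ab have "y * (real f + 1) * (b + y * d) \<le> (real M' + 1 - real f) * (a + y * b)"
    by (simp add: algebra_simps)
  then show ?case
    by (simp add: M(1) a_def b_def d_def add.commute split: nat.splits)
qed

text \<open>Maclaurin's inequality for numbers that are all \<open>y\<close> or \<open>1\<close>: it is what makes sampling
  without replacement no worse than sampling with replacement.\<close>

lemma hyper_sum_Suc_round:
  assumes y: "0 \<le> y" "y \<le> 1" and "t < M"
  shows "real M * hyper_sum y (Suc t) M f \<le> (real f + y * (real M - real f)) * hyper_sum y t M f"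
  using \<open>t < M\<close>
proof (induction t arbitrary: M f)
  case 0
  then obtain M' where M: "M = Suc M'"
    by (cases M) auto
  \<comment> \<open>For a single position the claim is an equality: \<open>good\<close> counts the
    fault sets containing it, \<open>bad\<close> those avoiding it.\<close>
  have bad: "real M * real (M' choose f) = (real M - real f) * real (M choose f)"
  proof -
    have "real (Suc f * (Suc M' choose Suc f)) = real (Suc M' * (M' choose f))"
      by (simp only: Suc_times_binomial)
    then show ?thesis
      using Suc_times_choose_Suc[of f M] by (simp add: M algebra_simps del: binomial_Suc_Suc)
  qed
  have good: "real M * (case f of 0 \<Rightarrow> 0 | Suc f' \<Rightarrow> real (M' choose f')) = real f * real (M choose f)"
  proof (cases f)
    case (Suc f')
    have "real (Suc f' * (Suc M' choose Suc f')) = real (Suc M' * (M' choose f'))"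
      by (simp only: Suc_times_binomial)
    then show ?thesis
      by (simp only: M Suc of_nat_mult nat.case)
  qed simp
  show ?case
    using good arg_cong[OF bad, of "\<lambda>z. y * z"] by (simp add: M algebra_simps split: nat.splits)
next
  case (Suc t)
  then obtain M' where M: "M = Suc M'" "t < M'"
    by (cases M) auto
  define N where "N = real M'"
  define r where "r = real f"
  have MN: "real M = N + 1" "N > 0"
    using M by (auto simp: N_def)
  define a where "a = (case f of 0 \<Rightarrow> 0 | Suc f' \<Rightarrow> hyper_sum y t M' f')"
  define a' where "a' = (case f of 0 \<Rightarrow> 0 | Suc f' \<Rightarrow> hyper_sum y (Suc t) M' f')"
  define b where "b = hyper_sum y t M' f"
  define b' where "b' = hyper_sum y (Suc t) M' f"
  have a: "N * a' \<le> (r - 1 + y * (N + 1 - r)) * a"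
  proof (cases f)
    case (Suc f')
    then show ?thesis
      using Suc.IH[OF M(2), of f'] by (simp add: a_def a'_def N_def r_def algebra_simps)
  qed (simp add: a_def a'_def)
  have b: "N * b' \<le> (r + y * (N - r)) * b"
    using Suc.IH[OF M(2), of f] by (simp add: b_def b'_def N_def r_def)
  have ab: "y * r * b \<le> (N + 1 - r) * a"
  proof (cases f)
    case (Suc f')
    then show ?thesis
      using hyper_sum_Suc_fault[OF y less_imp_le[OF M(2)], of f']
      by (simp add: a_def b_def N_def r_def algebra_simps)
  qed (simp add: a_def r_def)
  have "N * (a' + y * b') \<le> (r - 1 + y * (N + 1 - r)) * a + y * ((r + y * (N - r)) * b)"
    using a mult_left_mono[OF b y(1)] by (simp add: algebra_simps)
  then have "(N + 1) * (N * (a' + y * b'))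
      \<le> (N + 1) * ((r - 1 + y * (N + 1 - r)) * a + y * ((r + y * (N - r)) * b))"
    using MN by (intro mult_left_mono) auto
  \<comment> \<open>The mismatch between the two inductive factors and the wanted one collects in
    the last summand, which \<open>ab\<close>, the previous lemma at \<open>f - 1\<close>, makes
    nonpositive.\<close>
  also have "\<dots> = N * ((r + y * (N + 1 - r)) * (a + y * b)) + (1 - y) * (y * r * b - (N + 1 - r) * a)"
    by (simp add: algebra_simps)
  also have "\<dots> \<le> N * ((r + y * (N + 1 - r)) * (a + y * b))"
    using ab y by (simp add: mult_nonneg_nonpos)
  finally have "N * ((N + 1) * (a' + y * b')) \<le> N * ((r + y * (N + 1 - r)) * (a + y * b))"
    by (simp add: algebra_simps)
  then have "(N + 1) * (a' + y * b') \<le> (r + y * (N + 1 - r)) * (a + y * b)"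
    using MN by simp
  moreover have "hyper_sum y (Suc (Suc t)) M f = a' + y * b'"
    unfolding hyper_sum.simps(2)[of y "Suc t"] by (simp add: M(1) a'_def b'_def del: hyper_sum.simps split: nat.split)
  moreover have "hyper_sum y (Suc t) M f = a + y * b"
    by (simp add: M(1) a_def b_def split: nat.split)
  ultimately show ?case
    by (simp add: MN r_def)
qed

text \<open>Iterates the previous lemma; the base of the power is the mean of \<open>1\<close> and
  \<open>y\<close> under fault density \<open>f / M\<close>.\<close>

lemma hyper_sum_le:
  assumes y: "0 \<le> y" "y \<le> 1" and "t \<le> M" "f \<le> M" "0 < M"
  shows "hyper_sum y t M f \<le> real (M choose f) * ((real f + y * (real M - real f)) / real M) ^ t"
  using \<open>t \<le> M\<close>
proof (induction t)
  case (Suc t)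
  define q where "q = (real f + y * (real M - real f)) / real M"
  have "q \<ge> 0"
    using assms by (simp add: q_def)
  have "hyper_sum y (Suc t) M f \<le> q * hyper_sum y t M f"
    using hyper_sum_Suc_round[OF y, of t M f] Suc.prems \<open>0 < M\<close>
    by (simp add: q_def field_simps)
  also have "\<dots> \<le> q * (real (M choose f) * q ^ t)"
    using Suc \<open>q \<ge> 0\<close> by (intro mult_left_mono) (auto simp: q_def)
  finally show ?case
    by (simp add: q_def mult_ac del: hyper_sum.simps)
qed simp

section \<open>Counting the fault sets that keep a branch alive\<close>

text \<open>A successful call splits \<open>m\<close> remaining entries into two lists of at most \<open>m / 2\<close> entries,
  which multiplies the potential \<open>\<Sum> m powr \<alpha>\<close> by at most \<open>y = 2 powr (1 - \<alpha>)\<close>; a failed call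
  does not increase it.\<close>

lemma card_alive_le:
  fixes \<alpha> :: real
  assumes "\<alpha> \<ge> 0" "finite I" "set xs \<subseteq> I" "distinct xs"
  shows "real (card {G. G \<subseteq> I \<and> card G = f \<and> alive (\<lambda>i. i \<in> G) t xs})
    \<le> real (length xs) powr \<alpha> * hyper_sum (2 powr (1 - \<alpha>)) t (card I) f"
  using assms(2-)
proof (induction t arbitrary: I f xs)
  case 0
  show ?case
  proof (cases "xs = []")
    case False
    \<comment> \<open>A nonempty list has potential at least 1, so the potential dominates the
      indicator of survival. This is the Markov step.\<close>
    then have "1 \<le> real (length xs) powr \<alpha>"
      using assms(1) by (intro ge_one_powr_ge_zero) (auto simp: Suc_le_eq)
    then have "1 * real (card I choose f) \<le> real (length xs) powr \<alpha> * real (card I choose f)"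
      by (intro mult_right_mono) auto
    then show ?thesis
      using False n_subsets[OF 0(1), of f] by simp
  qed simp
next
  case (Suc t)
  define y :: real where "y = 2 powr (1 - \<alpha>)"
  show ?case
  proof (cases xs)
    case (Cons x ys)
    \<comment> \<open>Only the first position is exposed. The ground set is not split along with the
      list, because the \<open>f\<close> faults are spread over both halves; hence \<open>I\<close>
      may be larger than \<open>set xs\<close>.\<close>
    define J where "J = I - {x}"
    have J: "finite J" "x \<notin> J" "I = insert x J" "set ys \<subseteq> J" "card J = card I - 1"
      using Suc.prems by (auto simp: J_def Cons)
    define S where "S = (\<lambda>f zs. {G. G \<subseteq> J \<and> card G = f \<and> alive (\<lambda>i. i \<in> G) t zs})"
    have fin [simp]: "finite (S f zs)" for f zs
      using J(1) by (auto simp: S_def)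
    let ?m = "real (length xs)"
    \<comment> \<open>\<open>b\<close> will be the full length after a failed call, ignoring the
      deleted entry, and half of it after a split.\<close>
    have bound: "real (card (S f zs)) \<le> b powr \<alpha> * hyper_sum y t (card I - 1) f"
      if "set zs \<subseteq> set ys" "distinct zs" "real (length zs) \<le> b" for f zs and b :: real
    proof -
      have "real (card (S f zs)) \<le> real (length zs) powr \<alpha> * hyper_sum y t (card I - 1) f"
        unfolding S_def y_def J(5)[symmetric] using Suc.IH[of J zs f] J that by blast
      also have "\<dots> \<le> b powr \<alpha> * hyper_sum y t (card I - 1) f"
        using that assms(1) by (intro mult_right_mono powr_mono2 hyper_sum_nonneg) (auto simp: y_def)
      finally show ?thesis .
    qed
    have dist: "distinct ys"
      using Suc.prems by (simp add: Cons)
    have len: "real (length (ODD ys)) \<le> ?m / 2" "real (length (EVEN ys)) \<le> ?m / 2"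
      using length_ODD_EVEN[of ys] by (auto simp: Cons)
    \<comment> \<open>The potential of two half-length lists: this identity dictates
      \<open>y\<close>.\<close>
    have half: "2 * (?m / 2) powr \<alpha> = ?m powr \<alpha> * y"
      by (simp add: powr_divide y_def powr_diff)
    \<comment> \<open>Fault sets containing \<open>x\<close> correspond to sets with one fault fewer
      on \<open>J\<close>, and there are none for \<open>f = 0\<close>. For the others,
      \<open>sub\<close> takes the union over the two halves.\<close>
    define A where "A = (case f of 0 \<Rightarrow> {} | Suc f' \<Rightarrow> insert x ` S f' ys)"
    have sub: "{G. G \<subseteq> I \<and> card G = f \<and> alive (\<lambda>i. i \<in> G) (Suc t) xs}
        \<subseteq> A \<union> (S f (ODD ys) \<union> S f (EVEN ys))"
    proof (safe, goal_cases)
      case (1 G)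
      show ?case
      proof (cases "x \<in> G")
        case True
        define H where "H = G - {x}"
        have H: "G = insert x H" "x \<notin> H" "H \<subseteq> J" "finite H"
          using True 1 J finite_subset[of H J] by (auto simp: H_def)
        have "alive (\<lambda>i. i \<in> G) t ys = alive (\<lambda>i. i \<in> H) t ys"
          using J by (intro alive_cong) (auto simp: H_def)
        with 1 True have "alive (\<lambda>i. i \<in> H) t ys"
          by (simp add: Cons)
        with H have "G \<in> insert x ` S (card H) ys"
          by (auto simp: S_def)
        moreover have "card G = Suc (card H)"
          using H by simp
        ultimately show ?thesis
          using 1 by (auto simp: A_def)
      next
        case False
        with 1 have "G \<in> S (card G) (ODD ys) \<union> S (card G) (EVEN ys)"
          using J by (auto simp: S_def Cons)
        then show ?thesis using 1 by auto
      qed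
    qed
    have "finite A"
      by (auto simp: A_def split: nat.split)
    have "real (card A) \<le> (case f of 0 \<Rightarrow> 0 | Suc f' \<Rightarrow> real (card (S f' ys)))"
      by (auto simp: A_def card_image_le split: nat.split)
    also have "\<dots> \<le> ?m powr \<alpha> * (case f of 0 \<Rightarrow> 0 | Suc f' \<Rightarrow> hyper_sum y t (card I - 1) f')"
      using bound[of ys ?m] dist by (auto simp: Cons split: nat.split)
    finally have cA: "real (card A)
      \<le> ?m powr \<alpha> * (case f of 0 \<Rightarrow> 0 | Suc f' \<Rightarrow> hyper_sum y t (card I - 1) f')" .
    have cB: "real (card (S f (ODD ys))) + real (card (S f (EVEN ys)))
        \<le> 2 * (?m / 2) powr \<alpha> * hyper_sum y t (card I - 1) f"
      using bound[OF set_ODD_subset distinct_ODD[OF dist] len(1), of f]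
        bound[OF set_EVEN_subset distinct_EVEN[OF dist] len(2), of f] by simp
    have "card {G. G \<subseteq> I \<and> card G = f \<and> alive (\<lambda>i. i \<in> G) (Suc t) xs}
        \<le> card (A \<union> (S f (ODD ys) \<union> S f (EVEN ys)))"
      using sub \<open>finite A\<close> by (intro card_mono) auto
    also have "\<dots> \<le> card A + (card (S f (ODD ys)) + card (S f (EVEN ys)))"
      by (meson add_left_mono card_Un_le le_trans)
    finally have "real (card {G. G \<subseteq> I \<and> card G = f \<and> alive (\<lambda>i. i \<in> G) (Suc t) xs})
        \<le> real (card A) + (real (card (S f (ODD ys))) + real (card (S f (EVEN ys))))"
      by linarith
    also have "\<dots> \<le> ?m powr \<alpha> * hyper_sum y (Suc t) (card I) f"
      using cA cB unfolding half by (simp add: distrib_left mult.assoc)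
    finally show ?thesis
      by (simp only: y_def)
  qed simp
qed

section \<open>The faulty positions form a uniformly random subset\<close>

text \<open>Composing with a permutation of \<open>S\<close> that carries \<open>H\<close> to
  \<open>G\<close> injects the first set into the second; exchanging the roles gives
  equality.\<close>

lemma card_permutes_vimage_cong:
  assumes "finite S" "G \<subseteq> S" "H \<subseteq> S" "card G = card H"
  shows "card {\<pi>. \<pi> permutes S \<and> \<pi> -` F \<inter> S = G} = card {\<pi>. \<pi> permutes S \<and> \<pi> -` F \<inter> S = H}"
proof -
  have le: "card {\<pi>. \<pi> permutes S \<and> \<pi> -` F \<inter> S = G} \<le> card {\<pi>. \<pi> permutes S \<and> \<pi> -` F \<inter> S = H}"
    if GH: "G \<subseteq> S" "H \<subseteq> S" "card G = card H" for G H
  proof -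
    have fin: "finite G" "finite H"
      using GH assms(1) finite_subset by auto
    obtain g where g: "bij_betw g H G"
      using GH(3) fin finite_same_card_bij by metis
    have "card (S - H) = card (S - G)"
      using GH fin by (simp add: card_Diff_subset)
    then obtain h where h: "bij_betw h (S - H) (S - G)"
      using assms(1) finite_same_card_bij by (metis finite_Diff)
    define \<sigma> where "\<sigma> = (\<lambda>x. if x \<in> H then g x else if x \<in> S then h x else x)"
    have "bij_betw \<sigma> H G"
      using g by (subst bij_betw_cong[of _ _ g]) (auto simp: \<sigma>_def)
    moreover have "bij_betw \<sigma> (S - H) (S - G)"
      using h by (subst bij_betw_cong[of _ _ h]) (auto simp: \<sigma>_def)
    ultimately have "bij_betw \<sigma> (H \<union> (S - H)) (G \<union> (S - G))"
      by (rule bij_betw_combine) auto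
    moreover have "H \<union> (S - H) = S" "G \<union> (S - G) = S"
      using GH by auto
    ultimately have \<sigma>: "\<sigma> permutes S"
      using GH by (intro bij_imp_permutes) (auto simp: \<sigma>_def)
    have G: "\<sigma> x \<in> G \<longleftrightarrow> x \<in> H" if "x \<in> S" for x
      using g h that by (auto simp: \<sigma>_def bij_betw_def)
    show ?thesis
    proof (rule card_inj_on_le)
      show "inj_on (\<lambda>\<pi>. \<pi> \<circ> \<sigma>) {\<pi>. \<pi> permutes S \<and> \<pi> -` F \<inter> S = G}"
        using permutes_surj[OF \<sigma>] by (auto intro!: inj_onI simp: fun_eq_iff) (metis surjD)
      show "(\<lambda>\<pi>. \<pi> \<circ> \<sigma>) ` {\<pi>. \<pi> permutes S \<and> \<pi> -` F \<inter> S = G} \<subseteq> {\<pi>. \<pi> permutes S \<and> \<pi> -` F \<inter> S = H}"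
      proof (clarify, intro conjI)
        fix \<pi> assume \<pi>: "\<pi> permutes S" and F: "G = \<pi> -` F \<inter> S"
        show "\<pi> \<circ> \<sigma> permutes S"
          using \<sigma> \<pi> by (rule permutes_compose)
        show "(\<pi> \<circ> \<sigma>) -` F \<inter> S = H"
          using G permutes_in_image[OF \<sigma>] GH(2) by (auto simp: F)
      qed
      show "finite {\<pi>. \<pi> permutes S \<and> \<pi> -` F \<inter> S = H}"
        using finite_permutations[OF assms(1)] by (rule rev_finite_subset) auto
    qed
  qed
  show ?thesis
    using le[of G H] le[of H G] assms by simp
qed

lemma prob_permutes_vimage:
  assumes S: "finite S" "F \<subseteq> S"
  shows "measure_pmf.prob (pmf_of_set {\<pi>. \<pi> permutes S}) {\<pi>. P (\<pi> -` F \<inter> S)}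
    = real (card {G. G \<subseteq> S \<and> card G = card F \<and> P G}) / real (card S choose card F)"
proof -
  \<comment> \<open>The value of \<open>K\<close> is never computed: \<open>count\<close> for the
    trivial event shows that it is nonzero, and it cancels in the quotient.\<close>
  define K where "K = card {\<pi>. \<pi> permutes S \<and> \<pi> -` F \<inter> S = F}"
  have count: "card {\<pi>. \<pi> permutes S \<and> P (\<pi> -` F \<inter> S)} = K * card {G. G \<subseteq> S \<and> card G = card F \<and> P G}"
    for P
  proof -
    have "card (\<pi> -` F \<inter> S) = card F" if "\<pi> permutes S" for \<pi>
    proof -
      have "\<pi> ` (\<pi> -` F \<inter> S) = F"
        using S(2) permutes_image[OF that]
        by fast
      moreover have "inj_on \<pi> (\<pi> -` F \<inter> S)"
        using permutes_inj[OF that] by (rule inj_on_subset) auto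
      ultimately show ?thesis
        by (metis card_image)
    qed
    then have eq: "{\<pi>. \<pi> permutes S \<and> P (\<pi> -` F \<inter> S)}
        = (\<Union>G\<in>{G. G \<subseteq> S \<and> card G = card F \<and> P G}. {\<pi>. \<pi> permutes S \<and> \<pi> -` F \<inter> S = G})"
      by auto
    have "card \<dots> = (\<Sum>G\<in>{G. G \<subseteq> S \<and> card G = card F \<and> P G}. card {\<pi>. \<pi> permutes S \<and> \<pi> -` F \<inter> S = G})"
    proof (rule card_UN_disjoint)
      show "\<forall>G\<in>{G. G \<subseteq> S \<and> card G = card F \<and> P G}. finite {\<pi>. \<pi> permutes S \<and> \<pi> -` F \<inter> S = G}"
        using finite_permutations[OF S(1)] by (auto elim: rev_finite_subset)
    qed (use S(1) in auto)
    also have "\<dots> = (\<Sum>G\<in>{G. G \<subseteq> S \<and> card G = card F \<and> P G}. K)"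
      unfolding K_def by (intro sum.cong refl card_permutes_vimage_cong S) auto
    finally show ?thesis
      by (simp add: eq mult.commute)
  qed
  have total: "card {\<pi>. \<pi> permutes S} = K * (card S choose card F)"
    using count[of "\<lambda>_. True"] n_subsets[OF S(1), of "card F"] by simp
  have fin: "finite {\<pi>. \<pi> permutes S}" "{\<pi>. \<pi> permutes S} \<noteq> {}"
    using finite_permutations[OF S(1)] permutes_id[of S] by blast+
  then have "K \<noteq> 0"
    using total card_0_eq[OF fin(1)] by auto
  have "{\<pi>. \<pi> permutes S} \<inter> {\<pi>. P (\<pi> -` F \<inter> S)} = {\<pi>. \<pi> permutes S \<and> P (\<pi> -` F \<inter> S)}"
    by auto
  then have "measure_pmf.prob (pmf_of_set {\<pi>. \<pi> permutes S}) {\<pi>. P (\<pi> -` F \<inter> S)}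
      = real (K * card {G. G \<subseteq> S \<and> card G = card F \<and> P G}) / real (K * (card S choose card F))"
    using measure_pmf_of_set[OF fin(2,1)] count[of P] total by simp
  then show ?thesis
    using \<open>K \<noteq> 0\<close> by simp
qed

section \<open>The tail of the running time\<close>

text \<open>The exponent \<open>1 + log 2 c\<close> makes the weight of a successful call
  \<open>1 / c\<close>, hence the mean factor per round \<open>1 - p * (1 - 1 / c)\<close>, which is
  then bounded by an exponential.\<close>

lemma prob_gp_time_gt:
  assumes n: "n \<ge> 2" and F: "F \<subseteq> {1..n - 1}" and c: "c \<ge> 1"
  defines "p \<equiv> 1 - real (card F) / (real n - 1)"
  shows "measure_pmf.prob (gp_perm_pmf n) {\<pi>. t < gp_time n F \<pi>}
    \<le> (real n - 1) powr (1 + log 2 c) * exp (- p * (1 - 1 / c) * real t)"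
proof -
  define S where "S = {1..n - 1}"
  define P where "P = (\<lambda>G. alive (\<lambda>i. i \<in> G) t [1..<n])"
  define \<alpha> where "\<alpha> = 1 + log 2 c"
  define f where "f = card F"
  define N where "N = real n - 1"
  have S: "finite S" "card S = n - 1" "set [1..<n] \<subseteq> S"
    by (auto simp: S_def)
  have N: "N \<ge> 1" "real (n - 1) = N"
    using n by (auto simp: N_def of_nat_diff)
  have FS: "F \<subseteq> S"
    using F by (simp add: S_def)
  have pmf: "gp_perm_pmf n = pmf_of_set {\<pi>. \<pi> permutes S}"
    by (simp only: gp_perm_pmf_def S_def)
  have fS: "f \<le> n - 1"
    using card_mono[OF S(1) FS] S(2) by (simp add: f_def)
  have \<alpha>: "\<alpha> \<ge> 0" "2 powr (1 - \<alpha>) = 1 / c"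
    using c by (simp_all add: \<alpha>_def powr_minus divide_inverse)
  have "measure_pmf.prob (gp_perm_pmf n) {\<pi>. t < gp_time n F \<pi>}
      \<le> measure_pmf.prob (gp_perm_pmf n) {\<pi>. P (\<pi> -` F \<inter> S)}"
  proof (rule measure_pmf.finite_measure_mono_AE)
    have "P (\<pi> -` F \<inter> S)" if "\<pi> permutes S" "t < gp_time n F \<pi>" for \<pi>
    proof -
      have "alive (\<lambda>i. \<pi> i \<in> F) t [1..<n]"
        using that by (intro gp_time_gt_imp_alive) (auto simp: S_def)
      also have "alive (\<lambda>i. \<pi> i \<in> F) t [1..<n] \<longleftrightarrow> P (\<pi> -` F \<inter> S)"
        unfolding P_def using S(3) by (intro alive_cong) auto
      finally show ?thesis .
    qed
    moreover have "set_pmf (gp_perm_pmf n) = {\<pi>. \<pi> permutes S}"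
      unfolding pmf
      using finite_permutations[OF S(1)] permutes_id[of S] by (intro set_pmf_of_set) blast+
    ultimately show "AE \<pi> in measure_pmf (gp_perm_pmf n).
        \<pi> \<in> {\<pi>. t < gp_time n F \<pi>} \<longrightarrow> \<pi> \<in> {\<pi>. P (\<pi> -` F \<inter> S)}"
      by (auto simp: AE_measure_pmf_iff)
  qed simp
  also have "\<dots> = real (card {G. G \<subseteq> S \<and> card G = f \<and> P G}) / real (n - 1 choose f)"
    using prob_permutes_vimage[OF S(1) FS, of P] by (simp only: pmf f_def S(2))
  also have "\<dots> \<le> N powr \<alpha> * exp (- p * (1 - 1 / c) * real t)"
  \<comment> \<open>After \<open>n - 1\<close> rounds no branch survives, as each round shortens
    every list; in the other case \<open>t\<close> is in the range where \<open>hyper_sum\<close> is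
    meaningful.\<close>
  proof (cases "t < n - 1")
    case True
    have binom: "real (n - 1 choose f) > 0"
      using fS by simp
    have "real (card {G. G \<subseteq> S \<and> card G = f \<and> P G})
        \<le> real (length [1..<n]) powr \<alpha> * hyper_sum (2 powr (1 - \<alpha>)) t (card S) f"
      unfolding P_def using \<alpha>(1) S by (intro card_alive_le) auto
    also have "\<dots> = N powr \<alpha> * hyper_sum (1 / c) t (n - 1) f"
      by (simp only: \<alpha>(2) S(2) N(2) length_upt)
    also have "\<dots> \<le> N powr \<alpha> * (real (n - 1 choose f) * ((f + 1 / c * (N - f)) / N) ^ t)"
      using hyper_sum_le[of "1 / c" t "n - 1" f] c True fS n
      unfolding N(2) by (intro mult_left_mono) auto
    also have "(f + 1 / c * (N - f)) / N = 1 - p * (1 - 1 / c)"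
      using N(1) c by (simp add: p_def f_def[symmetric] N_def[symmetric] field_simps)
    also have "(1 - p * (1 - 1 / c)) ^ t \<le> exp (- (p * (1 - 1 / c))) ^ t"
    proof (rule power_mono)
      have "p \<le> 1" "0 \<le> 1 - 1 / c" "1 - 1 / c \<le> 1"
        using N(1) c by (auto simp: p_def N_def[symmetric])
      then have "p * (1 - 1 / c) \<le> 1"
        using mult_mono[of p 1 "1 - 1 / c" 1] by simp
      then show "0 \<le> 1 - p * (1 - 1 / c)"
        by simp
      show "1 - p * (1 - 1 / c) \<le> exp (- (p * (1 - 1 / c)))"
        using exp_ge_add_one_self[of "- (p * (1 - 1 / c))"] by simp
    qed
    also have "exp (- (p * (1 - 1 / c))) ^ t = exp (- p * (1 - 1 / c) * real t)"
      by (simp add: exp_of_nat_mult[symmetric] mult.commute)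
    finally have "real (card {G. G \<subseteq> S \<and> card G = f \<and> P G})
        \<le> N powr \<alpha> * (real (n - 1 choose f) * exp (- p * (1 - 1 / c) * real t))"
      by (simp add: mult_left_mono)
    then show ?thesis
      using binom by (simp add: pos_divide_le_eq mult_ac)
  next
    case False
    then have "\<not> P G" for G
      using alive_imp_less_length[of "\<lambda>i. i \<in> G" t "[1..<n]"] by (auto simp: P_def)
    then show ?thesis by simp
  qed
  finally show ?thesis
    by (simp only: N_def \<alpha>_def)
qed

text \<open>The two sides agree at \<open>c = 1\<close>, and their difference has derivative
  \<open>(1 - 1 / x)^2 / 2\<close>. The inequality compares the cost of branching,
  \<open>ln c\<close> per halving level, with the decay \<open>c - 1\<close>.\<close>

lemma chernoff_exponent:
  fixes c :: real
  assumes "c \<ge> 1"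
  shows "ln c \<le> c - 1 - (c - 1)\<^sup>2 / (2 * c)"
proof -
  define g where "g = (\<lambda>x::real. x - 1 - (x - 1)\<^sup>2 / (2 * x) - ln x)"
  have "g 1 \<le> g c"
  proof (rule DERIV_nonneg_imp_nondecreasing[OF assms])
    fix x :: real assume x: "1 \<le> x" "x \<le> c"
    have "(g has_real_derivative (1 - 1 / x)\<^sup>2 / 2) (at x)"
      unfolding g_def using x
      by (auto intro!: derivative_eq_intros simp: field_simps power2_eq_square)
    then show "\<exists>y. (g has_real_derivative y) (at x) \<and> 0 \<le> y"
      by (intro exI conjI) auto
  qed
  then show ?thesis
    by (simp add: g_def)
qed

theorem theorem12:
  fixes n f :: nat and F :: "nat set" and \<epsilon> p c :: real
  assumes "n \<ge> 2"
    and "\<epsilon> = sqrt (ln (real n) / (real n - 1))"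
    and "real f < (real n - 1) * (1 - \<epsilon>)"
    and "F \<subseteq> {1..n - 1}" and "card F = f"
    and "p = 1 - real f / (real n - 1)"
    and "c > 1"
  shows "measure_pmf.prob (gp_perm_pmf n)
           {\<pi>. real (gp_time n F \<pi>)
                 \<le> c / (p - \<epsilon>) * (real_of_int \<lceil>log 2 (real n - 1)\<rceil> + 1)}
         \<ge> 1 - real n ^ 3 / (real n ^ 2 - 1)
               * exp (- ((c - 1)\<^sup>2 / (2 * c)) * (real_of_int \<lceil>log 2 (real n - 1)\<rceil> - 1))"
proof -
  define N where "N = real n - 1"
  define K where "K = real_of_int \<lceil>log 2 N\<rceil>"
  define \<tau> where "\<tau> = c / (p - \<epsilon>) * (K + 1)"
  \<comment> \<open>The running time is an integer, so exceeding \<tau> means exceeding its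
    floor.\<close>
  define t where "t = nat \<lfloor>\<tau>\<rfloor>"
  define d where "d = (c - 1)\<^sup>2 / (2 * c)"
  have c: "c > 1" "1 - 1 / c \<ge> 0" "d \<ge> 0"
    using assms by (auto simp: d_def)
  have N: "N \<ge> 1"
    using assms by (simp add: N_def)
  have K: "K \<ge> log 2 N" "log 2 N \<ge> 0" "K \<ge> 0"
    using N zero_le_log_cancel_iff[of 2 N] le_of_int_ceiling[of "log 2 N"] unfolding K_def by linarith+
  have "\<epsilon> \<ge> 0"
    using assms by simp
  have "real f / N < 1 - \<epsilon>"
    using assms(3) N by (simp add: N_def[symmetric] pos_divide_less_eq mult.commute)
  moreover have "real f / N \<ge> 0"
    using N by simp
  moreover have "p = 1 - real f / N"
    using assms(6) by (simp add: N_def)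
  ultimately have p: "p > \<epsilon>" "p > 0" "p \<le> 1"
    using \<open>\<epsilon> \<ge> 0\<close> by linarith+
  have "\<tau> \<ge> 0"
    using c p K by (simp add: \<tau>_def)
  \<comment> \<open>Here \<epsilon> is given away: \<open>p - \<epsilon>\<close> is at most
    \<open>p\<close>.\<close>
  have "c * (K + 1) \<le> p * \<tau>"
  proof -
    have "c / p * (K + 1) \<le> \<tau>"
      unfolding \<tau>_def using c p K \<open>\<epsilon> \<ge> 0\<close> by (intro mult_right_mono divide_left_mono) auto
    then show ?thesis
      using p by (simp add: field_simps)
  qed
  \<comment> \<open>Rounding \<tau> down costs at most 1, as \<open>p \<le> 1\<close>. The
    \<open>+ 1\<close> next to \<open>K\<close> pays for it: the remainder
    \<open>(c - 1)\<^sup>2 / c\<close> below is nonnegative.\<close>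
  moreover have "\<tau> \<le> real t + 1"
    using \<open>\<tau> \<ge> 0\<close> unfolding t_def by linarith
  then have "p * \<tau> \<le> p * real t + 1"
    using p mult_left_mono[of \<tau> "real t + 1" p] by (simp add: distrib_left)
  ultimately have "c * (K + 1) - 1 \<le> p * real t"
    by simp
  then have "(1 - 1 / c) * (c * (K + 1) - 1) \<le> (1 - 1 / c) * (p * real t)"
    using c by (intro mult_left_mono)
  moreover have "(1 - 1 / c) * (c * (K + 1) - 1) = (c - 1) * K + (c - 1)\<^sup>2 / c"
    using c by (simp add: field_simps power2_eq_square)
  moreover have "(c - 1)\<^sup>2 / c \<ge> 0"
    using c by simp
  ultimately have rounds: "(c - 1) * K \<le> p * (1 - 1 / c) * real t"
    by (simp add: mult_ac)
  \<comment> \<open>That is, \<open>N powr log 2 c = c powr log 2 N\<close>, which expresses the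
    branching cost through the depth \<open>K\<close>.\<close>
  have "log 2 c * ln N = log 2 N * ln c"
    by (simp add: log_def)
  also have "\<dots> \<le> K * (c - 1 - d)"
    using chernoff_exponent[of c] c K unfolding d_def by (intro mult_mono) auto
  finally have paths: "log 2 c * ln N \<le> K * (c - 1 - d)" .

  have "measure_pmf.prob (gp_perm_pmf n) {\<pi>. t < gp_time n F \<pi>}
      \<le> N powr (1 + log 2 c) * exp (- p * (1 - 1 / c) * real t)"
    using prob_gp_time_gt[of n F c t] assms by (simp add: N_def)
  also have "\<dots> = N * exp (log 2 c * ln N - p * (1 - 1 / c) * real t)"
    using N by (simp add: powr_def distrib_right exp_add exp_diff exp_minus divide_inverse)
  also have "\<dots> \<le> N * exp (- d * (K - 1))"
  proof -
    \<comment> \<open>\<open>rounds\<close> and \<open>paths\<close> even give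
      \<open>- d * K\<close>; the claimed exponent leaves room for a factor
      \<open>exp d\<close>.\<close>
    have "log 2 c * ln N - p * (1 - 1 / c) * real t \<le> - d * (K - 1)"
      using rounds paths c by (simp add: algebra_simps)
    then show ?thesis
      using N by simp
  qed
  \<comment> \<open>The prefactor obtained is \<open>n - 1\<close>, and
    \<open>(n - 1) * (n\<^sup>2 - 1) \<le> n\<^sup>3\<close>.\<close>
  also have "\<dots> \<le> real n ^ 3 / (real n ^ 2 - 1) * exp (- d * (K - 1))"
  proof (rule mult_right_mono)
    have "real n ^ 2 > 1"
      using assms(1) by (intro one_less_power) auto
    then show "N \<le> real n ^ 3 / (real n ^ 2 - 1)"
      by (simp add: N_def field_simps power2_eq_square power3_eq_cube)
  qed simp
  finally have "measure_pmf.prob (gp_perm_pmf n) {\<pi>. t < gp_time n F \<pi>}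
      \<le> real n ^ 3 / (real n ^ 2 - 1) * exp (- d * (K - 1))" .
  moreover have "{\<pi>. t < gp_time n F \<pi>} = - {\<pi>. real (gp_time n F \<pi>) \<le> \<tau>}"
    using \<open>\<tau> \<ge> 0\<close> by (auto simp: t_def nat_less_iff floor_less_iff not_le)
  moreover have "measure_pmf.prob (gp_perm_pmf n) (- A) = 1 - measure_pmf.prob (gp_perm_pmf n) A" for A
    using measure_pmf.prob_compl[of A "gp_perm_pmf n"] by (simp add: Compl_eq_Diff_UNIV)
  ultimately show ?thesis
    by (simp add: \<tau>_def K_def N_def d_def)
qed

end
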